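(* Let $V$ and $W$ be $n$-graded vector spaces and let $E$ be the $(n+1)$-graded vector space with $E^{(0,* )}=V$, $E^{(1,* )}=W$ and $E^{(k,* )}=0$ for $k\ne0,1$ (that is, $E^{(0,x)}=V^x$, $E^{(1,x)}=W^x$ for $x\in\mathbb Z^n$). Let $P\in M^{(1,0,\dots,0)}(E)$, i.e. $P:E\times E\to E$ is bilinear of weight $0\in\mathbb Z^{n+1}$. Then $P$ defines a multigraded bimodule structure on $W$ if and only if $[P,P]^{\Delta}=0$. Here "$P$ defines a bimodule structure on $W$" means that the maps $\mu:V\times V\to V$ and $\lambda,\rho:V\to\operatorname{End}(W)$ given for homogeneous $X,X_1,X_2\in V$, $Y\in W$ of degrees $x,x_1,x_2,y\in\mathbb Z^n$ by $$\mu(X_1,X_2)=P(X_1,X_2),\qquad \lambda(X)Y=P(X,Y),\qquad \rho(X)Y=(-1)^{\langle x,y\rangle}P(Y,X)$$ make $(W,\lambda,\rho)$ a multigraded bimodule over $(V,\mu)$.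
   Context: All vector spaces are over a field $\mathbb K$ of characteristic $0$. For $x,y\in\mathbb Z^m$ put $\langle x,y\rangle=\sum_i x^iy^i$. An $m$-graded vector space is $U=\bigoplus_{x\in\mathbb Z^m}U^x$; the degree of a homogeneous element $X_i$ is denoted $x_i$. $\operatorname{End}(W)=\bigoplus_\delta\operatorname{End}^\delta(W)$, with $\operatorname{End}^\delta(W)$ the linear maps $D$ with $D(W^x)\subseteq W^{x+\delta}$. For an $m$-graded space $U$, $M(U)=\bigoplus_{(k,\kappa)\in\mathbb Z\times\mathbb Z^m}M^{(k,\kappa)}(U)$, where $M^{(k,\kappa)}(U)$ is the space of $(k+1)$-linear maps $K:U\times\dots\times U\to U$ with $K(U^{x_0}\times\dots\times U^{x_k})\subseteq U^{x_0+\dots+x_k+\kappa}$ ($\kappa$ is the weight). For $K_i\in M^{(k_i,\kappa_i)}(U)$, $$(j(K_1)K_2)(X_0,\dots,X_{k_1+k_2})=\sum_{i=0}^{k_2}(-1)^{k_1i+\langle\kappa_1,\kappa_2+x_0+\dots+x_{i-1}\rangle}K_2(X_0,\dots,K_1(X_i,\dots,X_{i+k_1}),\dots,X_{k_1+k_2}),$$ $$[K_1,K_2]^{\Delta}=j(K_1)K_2-(-1)^{k_1k_2+\langle\kappa_1,\kappa_2\rangle}j(K_2)K_1.$$ Multigraded bimodule: let $\mu:V\times V\to V$ be bilinear of weight $0$. A multigraded bimodule $(W,\lambda,\rho)$ over $(V,\mu)$ is given by linear maps $\lambda,\rho:V\to\operatorname{End}(W)$ of weight $0$ (so $\lambda(V^x),\rho(V^x)\subseteq\operatorname{End}^x(W)$)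 such that $[\mu,\mu]^{\Delta}=0$ (so $(V,\mu)$ is associative) and, for $X_i\in V^{x_i}$, $$\lambda(\mu(X_1,X_2))=\lambda(X_1)\circ\lambda(X_2),\quad \rho(\mu(X_1,X_2))=(-1)^{\langle x_1,x_2\rangle}\rho(X_2)\circ\rho(X_1),\quad \lambda(X_1)\circ\rho(X_2)=(-1)^{\langle x_1,x_2\rangle}\rho(X_2)\circ\lambda(X_1).$$ *)

theory Defs
  imports "HOL-Analysis.Product_Vector" "HOL-Library.Function_Algebras"
begin

(* Z^m is the set of integer sequences vanishing from position m on, with the pointwise
   group structure of Function_Algebras.  This lets Z^n and Z^(n+1) occur in one statement. *)

definition degs :: "nat \<Rightarrow> (nat \<Rightarrow> int) set"
  where "degs m = {x. \<forall>i\<ge>m. x i = 0}"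

definition deg_prod :: "nat \<Rightarrow> (nat \<Rightarrow> int) \<Rightarrow> (nat \<Rightarrow> int) \<Rightarrow> int"
  where "deg_prod m x y = (\<Sum>i<m. x i * y i)"

(* The values of a grading U outside degs m play no role. *)

definition is_decomposition ::
    "nat \<Rightarrow> ((nat \<Rightarrow> int) \<Rightarrow> 'u::ab_group_add set) \<Rightarrow> 'u \<Rightarrow> ((nat \<Rightarrow> int) \<Rightarrow> 'u) \<Rightarrow> bool"
  where "is_decomposition m U u c \<longleftrightarrow>
    (\<forall>x\<in>degs m. c x \<in> U x) \<and> (\<forall>x. x \<notin> degs m \<longrightarrow> c x = 0) \<and>
    finite {x. c x \<noteq> 0} \<and> u = (\<Sum>x | c x \<noteq> 0. c x)"

locale graded_vector_space = vector_space scale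
  for m :: nat
    and scale :: "'k::field_char_0 \<Rightarrow> 'u::ab_group_add \<Rightarrow> 'u" (infixr \<open>*s\<close> 75)
    and U :: "(nat \<Rightarrow> int) \<Rightarrow> 'u set" +
  assumes subspace_component: "x \<in> degs m \<Longrightarrow> subspace (U x)"
    and direct_sum: "\<exists>!c. is_decomposition m U u c"
begin

definition component :: "'u \<Rightarrow> (nat \<Rightarrow> int) \<Rightarrow> 'u"
  where "component u = (THE c. is_decomposition m U u c)"

definition homogeneous :: "(nat \<Rightarrow> int) list \<Rightarrow> 'u list \<Rightarrow> bool"
  where "homogeneous xs Xs \<longleftrightarrow> list_all2 (\<lambda>x X. x \<in> degs m \<and> X \<in> U x) xs Xs"

(* The space M^(k,\<kappa>)(U).  A (k+1)-linear map is a function on lists that is linear in each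
   entry of a list of length k+1; it is normalised to vanish on lists of any other length, so
   that equality of multilinear maps is equality of functions. *)

definition multi_maps :: "int \<Rightarrow> (nat \<Rightarrow> int) \<Rightarrow> ('u list \<Rightarrow> 'u) set"
  where "multi_maps k \<kappa> = {K.
    (\<forall>Xs. int (length Xs) \<noteq> k + 1 \<longrightarrow> K Xs = 0) \<and>
    (\<forall>Xs i. int (length Xs) = k + 1 \<longrightarrow> i < length Xs \<longrightarrow>
       Vector_Spaces.linear (*s) (*s) (\<lambda>X. K (Xs[i := X]))) \<and>
    (\<forall>xs Xs. int (length Xs) = k + 1 \<longrightarrow> homogeneous xs Xs \<longrightarrow> K Xs \<in> U (sum_list xs + \<kappa>))}"

(* A formula F given on homogeneous arguments (F xs Xs, where xs lists the degrees of Xs) is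
   extended to arbitrary arguments by splitting each of them into its homogeneous components. *)

definition multilinear_extension ::
    "((nat \<Rightarrow> int) list \<Rightarrow> 'u list \<Rightarrow> 'u) \<Rightarrow> 'u list \<Rightarrow> 'u"
  where "multilinear_extension F Xs =
    (\<Sum>xs \<in> listset (map (\<lambda>X. {x. component X x \<noteq> 0}) Xs). F xs (map2 component Xs xs))"

definition insertion_formula ::
    "int \<Rightarrow> (nat \<Rightarrow> int) \<Rightarrow> ('u list \<Rightarrow> 'u) \<Rightarrow> int \<Rightarrow> (nat \<Rightarrow> int) \<Rightarrow> ('u list \<Rightarrow> 'u) \<Rightarrow>
     (nat \<Rightarrow> int) list \<Rightarrow> 'u list \<Rightarrow> 'u"
  where "insertion_formula k1 \<kappa>1 K1 k2 \<kappa>2 K2 xs Xs =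
    (\<Sum>i<nat (k2 + 1).
       ((-1) powi (k1 * int i + deg_prod m \<kappa>1 (\<kappa>2 + sum_list (take i xs)))) *s
       K2 (take i Xs @ K1 (take (nat (k1 + 1)) (drop i Xs)) # drop (i + nat (k1 + 1)) Xs))"

(* insertion k1 \<kappa>1 K1 k2 \<kappa>2 K2 is j(K1)K2. *)

definition insertion ::
    "int \<Rightarrow> (nat \<Rightarrow> int) \<Rightarrow> ('u list \<Rightarrow> 'u) \<Rightarrow> int \<Rightarrow> (nat \<Rightarrow> int) \<Rightarrow> ('u list \<Rightarrow> 'u) \<Rightarrow>
     'u list \<Rightarrow> 'u"
  where "insertion k1 \<kappa>1 K1 k2 \<kappa>2 K2 Xs =
    (if int (length Xs) = k1 + k2 + 1
     then multilinear_extension (insertion_formula k1 \<kappa>1 K1 k2 \<kappa>2 K2) Xs else 0)"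

definition Delta_bracket ::
    "int \<Rightarrow> (nat \<Rightarrow> int) \<Rightarrow> ('u list \<Rightarrow> 'u) \<Rightarrow> int \<Rightarrow> (nat \<Rightarrow> int) \<Rightarrow> ('u list \<Rightarrow> 'u) \<Rightarrow>
     'u list \<Rightarrow> 'u"
  where "Delta_bracket k1 \<kappa>1 K1 k2 \<kappa>2 K2 = (\<lambda>Xs.
    insertion k1 \<kappa>1 K1 k2 \<kappa>2 K2 Xs
    - ((-1) powi (k1 * k2 + deg_prod m \<kappa>1 \<kappa>2)) *s insertion k2 \<kappa>2 K2 k1 \<kappa>1 K1 Xs)"

definition End_deg :: "(nat \<Rightarrow> int) \<Rightarrow> ('u \<Rightarrow> 'u) set"
  where "End_deg \<delta> = {D. Vector_Spaces.linear (*s) (*s) D \<and> (\<forall>x\<in>degs m. D ` U x \<subseteq> U (x + \<delta>))}"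

definition graded_End :: "('u \<Rightarrow> 'u) set"
  where "graded_End = {\<Sum>\<delta>\<in>A. D \<delta> | A D. finite A \<and> A \<subseteq> degs m \<and> (\<forall>\<delta>\<in>A. D \<delta> \<in> End_deg \<delta>)}"

lemma component_eqI: assumes "is_decomposition m U u c" shows "component u = c"
  unfolding component_def by (rule the_equality) (use direct_sum[of u] assms in blast)+

lemma component_homogeneous:
  assumes "x \<in> degs m" "X \<in> U x"
  shows "component X = (\<lambda>y. if y = x then X else 0)"
proof (rule component_eqI)
  have "{y. (if y = x then X else 0) \<noteq> 0} = (if X = 0 then {} else {x})" by auto
  then show "is_decomposition m U X (\<lambda>y. if y = x then X else 0)"
    unfolding is_decomposition_def using assms subspace_0[OF subspace_component] by auto
qed

lemma multilinear_extension_homogeneous: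
  assumes "homogeneous xs Xs" "0 \<in> set Xs \<Longrightarrow> F xs Xs = 0"
  shows "multilinear_extension F Xs = F xs Xs"
proof (cases "0 \<in> set Xs")
  case True
  have "component 0 = (\<lambda>_. 0)"
    by (rule component_eqI) (auto simp: is_decomposition_def intro!: subspace_0 subspace_component)
  then have "{x. component 0 x \<noteq> 0} = {}" by simp
  then have e: "{} \<in> set (map (\<lambda>X. {x. component X x \<noteq> 0}) Xs)"
    unfolding set_map using True by (intro image_eqI[of _ _ 0]) simp_all
  have "listset A = {}" if "{} \<in> set A" for A :: "(nat \<Rightarrow> int) set list"
    using that by (induction A) (auto simp: set_Cons_def)
  from this[OF e] have "listset (map (\<lambda>X. {x. component X x \<noteq> 0}) Xs) = {}" .
  then show ?thesis using True assms(2) by (simp add: multilinear_extension_def)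
next
  case False
  have "listset (map (\<lambda>X. {x. component X x \<noteq> 0}) Xs) = {xs} \<and> map2 component Xs xs = Xs"
    using assms(1) False unfolding homogeneous_def
  proof (induction rule: list_all2_induct)
    case (Cons x xs X Xs)
    then have "component X = (\<lambda>y. if y = x then X else 0)"
      by (intro component_homogeneous) auto
    moreover from this have "{y. component X y \<noteq> 0} = {x}" using Cons by auto
    moreover have "set_Cons {x} {xs} = {x # xs}" by (auto simp: set_Cons_def)
    ultimately show ?case using Cons by simp
  qed simp
  then show ?thesis by (simp add: multilinear_extension_def)
qed

lemma multi_maps_zero_entry:
  assumes "K \<in> multi_maps k \<kappa>" "0 \<in> set Xs"
  shows "K Xs = 0"
proof (cases "int (length Xs) = k + 1")
  case True
  obtain i where i: "i < length Xs" "Xs ! i = 0" using assms(2) by (metis in_set_conv_nth)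
  have "Vector_Spaces.linear (*s) (*s) (\<lambda>X. K (Xs[i := X]))"
    using assms(1) True i(1) by (simp add: multi_maps_def)
  from vector_space_pair.linear_0[OF _ this] i show ?thesis
    by (metis list_update_id vector_space_axioms vector_space_pair_def)
qed (use assms in \<open>auto simp: multi_maps_def\<close>)

(* On homogeneous arguments j(K1)K2 is given by the defining formula, also when some of the
   arguments are 0 (so that their degrees are not determined). *)

lemma insertion_homogeneous:
  assumes "K1 \<in> multi_maps k1 \<kappa>1" "K2 \<in> multi_maps k2 \<kappa>2"
    and "homogeneous xs Xs" "int (length Xs) = k1 + k2 + 1"
  shows "insertion k1 \<kappa>1 K1 k2 \<kappa>2 K2 Xs = insertion_formula k1 \<kappa>1 K1 k2 \<kappa>2 K2 xs Xs"
proof -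
  have "K2 (take i Xs @ K1 (take (nat (k1 + 1)) (drop i Xs)) # drop (i + nat (k1 + 1)) Xs) = 0"
    if "0 \<in> set Xs" for i
  proof -
    have "Xs = take i Xs @ take (nat (k1 + 1)) (drop i Xs) @ drop (i + nat (k1 + 1)) Xs"
      by (metis append_take_drop_id drop_drop add.commute)
    then have "0 \<in> set (take i Xs) \<union> set (take (nat (k1 + 1)) (drop i Xs))
        \<union> set (drop (i + nat (k1 + 1)) Xs)"
      using that by (metis Un_assoc set_append)
    then show ?thesis
      using multi_maps_zero_entry[OF assms(1), of "take (nat (k1 + 1)) (drop i Xs)"]
      by (intro multi_maps_zero_entry[OF assms(2)]) auto
  qed
  then show ?thesis using assms(3,4)
    by (simp add: insertion_def insertion_formula_def
        multilinear_extension_homogeneous[where F = "insertion_formula k1 \<kappa>1 K1 k2 \<kappa>2 K2"])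
qed

end

(* mu is a bilinear map in the list form of multi_maps, with mu(X1,X2) = mu [X1, X2]. *)

locale multigraded_bimodule =
  V: graded_vector_space m scaleV V + W: graded_vector_space m scaleW W
  for m :: nat
    and scaleV :: "'k::field_char_0 \<Rightarrow> 'v::ab_group_add \<Rightarrow> 'v"
    and V :: "(nat \<Rightarrow> int) \<Rightarrow> 'v set"
    and scaleW :: "'k \<Rightarrow> 'w::ab_group_add \<Rightarrow> 'w"
    and W :: "(nat \<Rightarrow> int) \<Rightarrow> 'w set"
    and mu :: "'v list \<Rightarrow> 'v"
    and lam :: "'v \<Rightarrow> 'w \<Rightarrow> 'w"
    and rho :: "'v \<Rightarrow> 'w \<Rightarrow> 'w" +
  assumes mu: "mu \<in> V.multi_maps 1 0"
    and lam_linear: "Vector_Spaces.linear scaleV (\<lambda>c D Y. scaleW c (D Y)) lam"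
    and lam_End: "range lam \<subseteq> W.graded_End"
    and lam_weight: "x \<in> degs m \<Longrightarrow> lam ` V x \<subseteq> W.End_deg x"
    and rho_linear: "Vector_Spaces.linear scaleV (\<lambda>c D Y. scaleW c (D Y)) rho"
    and rho_End: "range rho \<subseteq> W.graded_End"
    and rho_weight: "x \<in> degs m \<Longrightarrow> rho ` V x \<subseteq> W.End_deg x"
    and mu_bracket: "V.Delta_bracket 1 0 mu 1 0 mu = 0"
    and lam_mu: "\<lbrakk>x1 \<in> degs m; x2 \<in> degs m; X1 \<in> V x1; X2 \<in> V x2\<rbrakk> \<Longrightarrow>
      lam (mu [X1, X2]) = lam X1 \<circ> lam X2"
    and rho_mu: "\<lbrakk>x1 \<in> degs m; x2 \<in> degs m; X1 \<in> V x1; X2 \<in> V x2\<rbrakk> \<Longrightarrow>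
      rho (mu [X1, X2]) = (\<lambda>Y. scaleW ((-1) powi deg_prod m x1 x2) ((rho X2 \<circ> rho X1) Y))"
    and lam_rho: "\<lbrakk>x1 \<in> degs m; x2 \<in> degs m; X1 \<in> V x1; X2 \<in> V x2\<rbrakk> \<Longrightarrow>
      lam X1 \<circ> rho X2 = (\<lambda>Y. scaleW ((-1) powi deg_prod m x1 x2) ((rho X2 \<circ> lam X1) Y))"

(* E is realised on V \<times> W; a degree z of Z^(n+1) is (z 0, x) with x i = z (i+1). *)

definition E_grading ::
    "((nat \<Rightarrow> int) \<Rightarrow> 'v::zero set) \<Rightarrow> ((nat \<Rightarrow> int) \<Rightarrow> 'w::zero set) \<Rightarrow> (nat \<Rightarrow> int) \<Rightarrow> ('v \<times> 'w) set"
  where "E_grading V W z =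
    (if z 0 = 0 then V (\<lambda>i. z (Suc i)) \<times> {0}
     else if z 0 = 1 then {0} \<times> W (\<lambda>i. z (Suc i))
     else {0})"

lemma E_graded:
  assumes "graded_vector_space n scaleV V" "graded_vector_space n scaleW W"
  shows "graded_vector_space (Suc n) (module_prod.scale scaleV scaleW) (E_grading V W)"
proof -
  interpret V: graded_vector_space n scaleV V by fact
  interpret W: graded_vector_space n scaleW W by fact
  interpret E: vector_space_prod scaleV scaleW by unfold_locales
  let ?t = "\<lambda>(z::nat\<Rightarrow>int) i. z (Suc i)"
  have tl: "?t z \<in> degs n" if "z \<in> degs (Suc n)" for z using that by (auto simp: degs_def)
  have cn: "case_nat k x \<in> degs (Suc n) \<longleftrightarrow> x \<in> degs n" for k x
    unfolding degs_def mem_Collect_eq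
  proof (intro iffI allI impI)
    fix i assume "\<forall>i\<ge>Suc n. case_nat k x i = 0" "n \<le> i"
    then have "case_nat k x (Suc i) = 0" by blast
    then show "x i = 0" by simp
  qed (simp split: nat.split)
  have cz: "case_nat (z 0) (?t z) = z" for z :: "nat \<Rightarrow> int"
    by (rule ext) (simp split: nat.split)
  have inj: "inj (case_nat (k::int))" for k
  proof (rule injI, rule ext)
    fix x y :: "nat \<Rightarrow> int" and i assume "case_nat k x = case_nat k y"
    from fun_cong[OF this, of "Suc i"] show "x i = y i" by simp
  qed
  show ?thesis
  proof
    fix z assume z: "z \<in> degs (Suc n)"
    note s = V.subspace_component[OF tl[OF z]] W.subspace_component[OF tl[OF z]]
    show "E.p.subspace (E_grading V W z)"
      using s unfolding E.p.subspace_def V.subspace_def W.subspace_def E_grading_def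
      by (auto simp: E.scale_def zero_prod_def)
  next
    fix u :: "'b \<times> 'c"
    obtain a b where u: "u = (a, b)" by fastforce
    obtain c where c: "is_decomposition n V a c" using V.direct_sum by blast
    obtain d where d: "is_decomposition n W b d" using W.direct_sum by blast
    define e where "e z = (if z 0 = 0 then (c (?t z), 0) else if z 0 = 1 then (0, d (?t z)) else 0)" for z
    let ?A = "case_nat 0 ` {x. c x \<noteq> 0}" and ?B = "case_nat 1 ` {x. d x \<noteq> 0}"
    have fin: "finite {x. c x \<noteq> 0}" "finite {x. d x \<noteq> 0}" using c d by (auto simp: is_decomposition_def)
    have supp: "{z. e z \<noteq> 0} = ?A \<union> ?B"
    proof (intro equalityI subsetI)
      fix z assume "z \<in> {z. e z \<noteq> 0}"
      then show "z \<in> ?A \<union> ?B"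
        using cz[of z] by (auto simp: e_def zero_prod_def image_iff split: if_splits)
    qed (auto simp: e_def zero_prod_def)
    have "(\<Sum>z | e z \<noteq> 0. e z) = (\<Sum>z\<in>?A. e z) + (\<Sum>z\<in>?B. e z)"
      unfolding supp by (rule sum.union_disjoint) (auto simp: fin dest: fun_cong[of _ _ 0])
    also have "(\<Sum>z\<in>?A. e z) = (\<Sum>x | c x \<noteq> 0. (c x, 0))"
      by (simp add: sum.reindex[OF inj_on_subset[OF inj subset_UNIV]] e_def)
    also have "(\<Sum>z\<in>?B. e z) = (\<Sum>x | d x \<noteq> 0. (0, d x))"
      by (simp add: sum.reindex[OF inj_on_subset[OF inj subset_UNIV]] e_def)
    also have "(\<Sum>x | c x \<noteq> 0. (c x, 0::'c)) + (\<Sum>x | d x \<noteq> 0. (0, d x)) = u"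
      using c d by (auto simp: u is_decomposition_def sum_prod[symmetric] prod_eq_iff fst_sum snd_sum)
    finally have sum: "u = (\<Sum>z | e z \<noteq> 0. e z)" by simp
    have "is_decomposition (Suc n) (E_grading V W) u e"
      unfolding is_decomposition_def
    proof (intro conjI ballI allI impI)
      show "u = (\<Sum>z | e z \<noteq> 0. e z)" by fact
      show "finite {z. e z \<noteq> 0}" unfolding supp using fin by auto
      fix z
      show "e z \<in> E_grading V W z" if "z \<in> degs (Suc n)"
        using c d tl[OF that] by (auto simp: e_def E_grading_def is_decomposition_def)
      show "e z = 0" if "z \<notin> degs (Suc n)"
      proof -
        have "?t z \<notin> degs n" using that cn[of "z 0" "?t z"] cz[of z] by auto
        then show ?thesis using c d by (auto simp: e_def is_decomposition_def zero_prod_def)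
      qed
    qed
    moreover have "f = e" if f: "is_decomposition (Suc n) (E_grading V W) u f" for f
    proof -
      have f0: "f z = 0" if "z \<notin> degs (Suc n)" for z using f that by (auto simp: is_decomposition_def)
      have fE: "f z \<in> E_grading V W z" if "z \<in> degs (Suc n)" for z using f that by (auto simp: is_decomposition_def)
      have ff: "finite {z. f z \<noteq> 0}" and fu: "u = (\<Sum>z | f z \<noteq> 0. f z)" using f by (auto simp: is_decomposition_def)
      define c' where "c' x = fst (f (case_nat 0 x))" for x
      define d' where "d' x = snd (f (case_nat 1 x))" for x
      have fstf: "fst (f z) = 0" if "z 0 \<noteq> 0" for z
        using f0[of z] fE[of z] that by (cases "z \<in> degs (Suc n)") (auto simp: E_grading_def split: if_splits)
      have sndf: "snd (f z) = 0" if "z 0 \<noteq> 1" for z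
        using f0[of z] fE[of z] that by (cases "z \<in> degs (Suc n)") (auto simp: E_grading_def split: if_splits)
      have fc: "finite {x. c' x \<noteq> 0}"
        by (rule finite_imageD[OF finite_subset[OF _ ff] inj_on_subset[OF inj[of 0] subset_UNIV]]) (auto simp: c'_def)
      have fd: "finite {x. d' x \<noteq> 0}"
        by (rule finite_imageD[OF finite_subset[OF _ ff] inj_on_subset[OF inj[of 1] subset_UNIV]]) (auto simp: d'_def)
      have "a = (\<Sum>z | f z \<noteq> 0. fst (f z))" using fu by (simp add: u fst_sum[symmetric]) (metis fst_conv)
      also have "\<dots> = (\<Sum>z\<in>case_nat 0 ` {x. c' x \<noteq> 0}. fst (f z))"
      proof (rule sum.mono_neutral_right[OF ff])
        show "\<forall>z\<in>{z. f z \<noteq> 0} - case_nat 0 ` {x. c' x \<noteq> 0}. fst (f z) = 0"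
          using fstf cz by (auto simp: c'_def image_iff) metis
      qed (auto simp: c'_def)
      also have "\<dots> = (\<Sum>x | c' x \<noteq> 0. c' x)"
        by (subst sum.reindex) (auto intro: inj_on_subset[OF inj] simp: c'_def)
      finally have A: "a = (\<Sum>x | c' x \<noteq> 0. c' x)" .
      have "b = (\<Sum>z | f z \<noteq> 0. snd (f z))" using fu by (simp add: u snd_sum[symmetric]) (metis snd_conv)
      also have "\<dots> = (\<Sum>z\<in>case_nat 1 ` {x. d' x \<noteq> 0}. snd (f z))"
      proof (rule sum.mono_neutral_right[OF ff])
        show "\<forall>z\<in>{z. f z \<noteq> 0} - case_nat 1 ` {x. d' x \<noteq> 0}. snd (f z) = 0"
          using sndf cz by (auto simp: d'_def image_iff) metis
      qed (auto simp: d'_def)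
      also have "\<dots> = (\<Sum>x | d' x \<noteq> 0. d' x)"
        by (subst sum.reindex) (auto intro: inj_on_subset[OF inj] simp: d'_def)
      finally have B: "b = (\<Sum>x | d' x \<noteq> 0. d' x)" .
      have "is_decomposition n V a c'" unfolding is_decomposition_def
        using A fc fE[of "case_nat 0 _"] f0[of "case_nat 0 _"] cn
        by (auto simp: c'_def E_grading_def) (metis mem_Times_iff)
      then have "c' = c" using c V.direct_sum by blast
      moreover have "is_decomposition n W b d'" unfolding is_decomposition_def
        using B fd fE[of "case_nat 1 _"] f0[of "case_nat 1 _"] cn
        by (auto simp: d'_def E_grading_def) (metis mem_Times_iff)
      then have "d' = d" using d W.direct_sum by blast
      ultimately show "f = e"
      proof (intro ext)
        fix z
        show "f z = e z"
          using fstf[of z] sndf[of z] \<open>c' = c\<close>[symmetric] \<open>d' = d\<close>[symmetric] cz[of z]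
          by (auto simp: e_def c'_def d'_def prod_eq_iff)
      qed
    qed
    ultimately show "\<exists>!e. is_decomposition (Suc n) (E_grading V W) u e" by blast
  qed
qed

(* mu, lam, rho are (bi)linear by multigraded_bimodule, hence uniquely determined by the
   prescribed values on homogeneous elements.  The other component of P vanishes in each of
   the three cases because P has weight 0. *)

definition defines_bimodule ::
    "nat \<Rightarrow> ('k::field_char_0 \<Rightarrow> 'v::ab_group_add \<Rightarrow> 'v) \<Rightarrow> ((nat \<Rightarrow> int) \<Rightarrow> 'v set) \<Rightarrow>
     ('k \<Rightarrow> 'w::ab_group_add \<Rightarrow> 'w) \<Rightarrow> ((nat \<Rightarrow> int) \<Rightarrow> 'w set) \<Rightarrow>
     (('v \<times> 'w) list \<Rightarrow> 'v \<times> 'w) \<Rightarrow> bool"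
  where "defines_bimodule n scaleV V scaleW W P \<longleftrightarrow> (\<exists>mu lam rho.
    (\<forall>x1\<in>degs n. \<forall>x2\<in>degs n. \<forall>X1\<in>V x1. \<forall>X2\<in>V x2. (mu [X1, X2], 0) = P [(X1, 0), (X2, 0)]) \<and>
    (\<forall>x\<in>degs n. \<forall>y\<in>degs n. \<forall>X\<in>V x. \<forall>Y\<in>W y.
       (0, lam X Y) = P [(X, 0), (0, Y)] \<and>
       (0, rho X Y) =
         module_prod.scale scaleV scaleW ((-1) powi deg_prod n x y) (P [(0, Y), (X, 0)])) \<and>
    multigraded_bimodule n scaleV V scaleW W mu lam rho)"

end

theory Submission
  imports Defs
begin

text \<open>
  For a bilinear \<open>P\<close> of weight zero the two insertions in \<open>[P, P]\<close> coincide and the sign between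
  them is \<open>-1\<close>, so the bracket is twice the associator
  \<open>P(P(A, B), C) - P(A, P(B, C))\<close>.  In characteristic zero it therefore vanishes iff \<open>P\<close> is
  associative, and by multilinearity homogeneous arguments suffice to test this
  (\<open>Delta_bracket_eq_0_iff_associative\<close>).  The same criterion serves \<open>P\<close> on \<open>E\<close> and \<open>\<mu>\<close> on \<open>V\<close>.

  The extra degree of \<open>E\<close> counts the factors from \<open>W\<close>.  Since it takes only the values 0 and 1, a
  weight-zero \<open>P\<close> consists of a product \<open>V \<times> V \<rightarrow> V\<close> and two actions \<open>V \<times> W \<rightarrow> W\<close> and \<open>W \<times> V \<rightarrow> W\<close>,
  and kills \<open>W \<times> W\<close>.  Of the eight types of homogeneous triples, the four with at least two
  entries in \<open>W\<close> satisfy associativity trivially; the types \<open>VVV\<close>, \<open>VVW\<close>, \<open>VWV\<close>, \<open>WVV\<close> give four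
  identities (\<open>bracket_eq_0_iff_bimodule_identities\<close>).  They are, in this order, the associativity
  of \<open>\<mu>\<close>, multiplicativity of \<open>\<lambda>\<close>, the commutation of \<open>\<lambda>\<close> with \<open>\<rho>\<close>, and antimultiplicativity of \<open>\<rho>\<close>,
  because the sign in \<open>\<rho>(X)Y = (-1)\<^bsup>\<langle>x,y\<rangle>\<^esup> P(Y, X)\<close> absorbs exactly the signs of the bimodule
  axioms (\<open>rho_product_iff\<close>, \<open>left_act_rho_iff\<close>).

  Two points go beyond this computation when a bimodule has to be built from \<open>P\<close>.  The sign in \<open>\<rho>\<close>
  depends on degrees, so \<open>\<rho>\<close> is first defined on homogeneous elements and then extended linearly
  in both variables (\<open>signed_right_act\<close>); and the axioms are equations between operators on all
  of \<open>W\<close>, which follow from their homogeneous instances because both sides are linear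
  (\<open>linear_eq_on_homogeneous\<close>).
\<close>

section \<open>Homogeneous components and linear maps\<close>

lemma deg_prod_commute: "deg_prod m x y = deg_prod m y x"
  by (simp add: deg_prod_def mult.commute)

lemma deg_prod_add_right: "deg_prod m x (y + z) = deg_prod m x y + deg_prod m x z"
  by (simp add: deg_prod_def algebra_simps sum.distrib)

lemma deg_prod_add_left: "deg_prod m (x + y) z = deg_prod m x z + deg_prod m y z"
  by (simp add: deg_prod_def algebra_simps sum.distrib)

lemma add_in_degs: "x \<in> degs m \<Longrightarrow> y \<in> degs m \<Longrightarrow> x + y \<in> degs m"
  by (simp add: degs_def)

lemma minus_one_powi_add: "(-1::'a::field) powi (a + b) = (-1) powi a * (-1) powi b"
  by (simp add: power_int_add)

context graded_vector_space
begin

lemma is_decomposition_component: "is_decomposition m U u (component u)"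
  using direct_sum[of u] component_eqI by metis

lemma component_in: "x \<in> degs m \<Longrightarrow> component u x \<in> U x"
  using is_decomposition_component[of u] by (simp add: is_decomposition_def)

lemma component_nonzero_degs: "component u x \<noteq> 0 \<Longrightarrow> x \<in> degs m"
  using is_decomposition_component[of u] by (auto simp: is_decomposition_def)

lemma component_outside_degs: "x \<notin> degs m \<Longrightarrow> component u x = 0"
  using component_nonzero_degs by blast

lemma finite_components: "finite {x. component u x \<noteq> 0}"
  using is_decomposition_component[of u] by (simp add: is_decomposition_def)

lemma sum_components: "(\<Sum>x | component u x \<noteq> 0. component u x) = u"
  using is_decomposition_component[of u] by (simp add: is_decomposition_def)

lemma sum_components_superset:
  assumes "finite A" "{x. component u x \<noteq> 0} \<subseteq> A"
  shows "(\<Sum>x\<in>A. component u x) = u"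
proof -
  have "(\<Sum>x\<in>A. component u x) = (\<Sum>x | component u x \<noteq> 0. component u x)"
    using assms by (intro sum.mono_neutral_right) auto
  then show ?thesis by (simp add: sum_components)
qed

lemma component_add: "component (u + v) x = component u x + component v x"
proof -
  let ?A = "{x. component u x \<noteq> 0} \<union> {x. component v x \<noteq> 0}"
  let ?c = "\<lambda>x. component u x + component v x"
  have fin: "finite ?A" by (simp add: finite_components)
  have "u + v = (\<Sum>x\<in>?A. ?c x)"
    using sum_components_superset[OF fin, of u] sum_components_superset[OF fin, of v]
    by (auto simp: sum.distrib)
  also have "\<dots> = (\<Sum>x | ?c x \<noteq> 0. ?c x)"
    using fin by (intro sum.mono_neutral_right) auto
  finally have "is_decomposition m U (u + v) ?c"
    unfolding is_decomposition_def
    by (auto simp: component_in component_outside_degs intro!: subspace_add subspace_component finite_subset[OF _ fin])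
  then show ?thesis by (simp add: component_eqI)
qed

lemma component_scale: "component (a *s u) x = a *s component u x"
proof -
  let ?c = "\<lambda>x. a *s component u x"
  have "a *s u = (\<Sum>x | component u x \<noteq> 0. ?c x)"
    by (simp add: sum_components flip: scale_sum_right)
  also have "\<dots> = (\<Sum>x | ?c x \<noteq> 0. ?c x)"
    using finite_components by (intro sum.mono_neutral_right) auto
  finally have "is_decomposition m U (a *s u) ?c"
    unfolding is_decomposition_def
    by (auto simp: component_in component_outside_degs intro!: subspace_scale subspace_component finite_subset[OF _ finite_components[of u]])
  then show ?thesis by (simp add: component_eqI)
qed

text \<open>
  This is the device for defining linear maps by formulas that mention the degree of the argument.
\<close>

definition componentwise :: "((nat \<Rightarrow> int) \<Rightarrow> 'u \<Rightarrow> 'b::ab_group_add) \<Rightarrow> 'u \<Rightarrow> 'b"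
  where "componentwise f u = (\<Sum>x | component u x \<noteq> 0. f x (component u x))"

lemma componentwise_homogeneous:
  assumes "x \<in> degs m" "X \<in> U x" "f x 0 = 0"
  shows "componentwise f X = f x X"
proof -
  have "{y. component X y \<noteq> 0} = (if X = 0 then {} else {x})"
    by (auto simp: component_homogeneous[OF assms(1,2)])
  then show ?thesis
    using assms by (simp add: componentwise_def component_homogeneous[OF assms(1,2)])
qed

lemma linear_componentwise:
  assumes s: "vector_space s" and f: "\<And>x. Vector_Spaces.linear (*s) s (f x)"
  shows "Vector_Spaces.linear (*s) s (componentwise f)"
proof -
  interpret T: vector_space s by fact
  have f_add: "f x (X + Y) = f x X + f x Y" and f_scale: "f x (a *s X) = s a (f x X)" for x X Y a
    using f[of x] by (simp_all add: Vector_Spaces.linear_iff)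
  have f0: "f x 0 = 0" for x using f_add[of x 0 0] by simp
  \<comment> \<open>The supports of \<open>u\<close>, \<open>v\<close> and \<open>u + v\<close> differ, so all sums are moved to a common index set.\<close>
  have superset: "componentwise f u = (\<Sum>x\<in>A. f x (component u x))"
    if "finite A" "{x. component u x \<noteq> 0} \<subseteq> A" for A u
    unfolding componentwise_def using that by (intro sum.mono_neutral_left) (auto simp: f0)
  have "componentwise f (u + v) = componentwise f u + componentwise f v" for u v
  proof -
    let ?A = "{x. component u x \<noteq> 0} \<union> {x. component v x \<noteq> 0}"
    have fin: "finite ?A" by (simp add: finite_components)
    have "{x. component (u + v) x \<noteq> 0} \<subseteq> ?A" by (auto simp: component_add)
    from superset[OF fin this] superset[OF fin, of u] superset[OF fin, of v] show ?thesis
      by (auto simp: component_add f_add sum.distrib)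
  qed
  moreover have "componentwise f (a *s u) = s a (componentwise f u)" for a u
  proof -
    have "{x. component (a *s u) x \<noteq> 0} \<subseteq> {x. component u x \<noteq> 0}" by (auto simp: component_scale)
    from superset[OF finite_components this] show ?thesis
      by (simp add: componentwise_def component_scale f_scale T.scale_sum_right)
  qed
  ultimately show ?thesis using s vector_space_axioms by (simp add: Vector_Spaces.linear_iff)
qed

lemma linear_eq_on_homogeneous:
  assumes "Vector_Spaces.linear (*s) s f" "Vector_Spaces.linear (*s) s g"
    and eq: "\<And>x X. x \<in> degs m \<Longrightarrow> X \<in> U x \<Longrightarrow> f X = g X"
  shows "f = g"
proof
  fix u
  interpret f: Vector_Spaces.linear "(*s)" s f by fact
  interpret g: Vector_Spaces.linear "(*s)" s g by fact
  have "f u = (\<Sum>x | component u x \<noteq> 0. f (component u x))"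
    by (metis f.sum sum_components)
  also have "\<dots> = (\<Sum>x | component u x \<noteq> 0. g (component u x))"
    by (intro sum.cong refl eq[OF component_nonzero_degs component_in[OF component_nonzero_degs]])
      auto
  also have "\<dots> = g u" by (metis g.sum sum_components)
  finally show "f u = g u" .
qed

lemma multi_maps_1_iff:
  "K \<in> multi_maps 1 \<kappa> \<longleftrightarrow>
    (\<forall>Xs. length Xs \<noteq> 2 \<longrightarrow> K Xs = 0) \<and>
    (\<forall>Y. Vector_Spaces.linear (*s) (*s) (\<lambda>X. K [X, Y])) \<and>
    (\<forall>X. Vector_Spaces.linear (*s) (*s) (\<lambda>Y. K [X, Y])) \<and>
    (\<forall>x\<in>degs m. \<forall>y\<in>degs m. \<forall>X\<in>U x. \<forall>Y\<in>U y. K [X, Y] \<in> U (x + y + \<kappa>))"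
proof -
  have len: "int (length Xs) = 1 + 1 \<longleftrightarrow> length Xs = 2" for Xs :: "'u list" by auto
  have ex_entry: "(\<forall>Xs i. length Xs = 2 \<longrightarrow> i < length Xs \<longrightarrow> Q Xs i) \<longleftrightarrow>
      (\<forall>X Y. Q [X, Y] 0 \<and> Q [X, Y] 1)" for Q :: "'u list \<Rightarrow> nat \<Rightarrow> bool"
    by (auto simp: numeral_2_eq_2 length_Suc_conv less_Suc_eq)
  have lin: "(\<forall>Xs i. length Xs = 2 \<longrightarrow> i < length Xs \<longrightarrow>
       Vector_Spaces.linear (*s) (*s) (\<lambda>X. K (Xs[i := X]))) \<longleftrightarrow>
    (\<forall>Y. Vector_Spaces.linear (*s) (*s) (\<lambda>X. K [X, Y])) \<and>
    (\<forall>X. Vector_Spaces.linear (*s) (*s) (\<lambda>Y. K [X, Y]))"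
    unfolding ex_entry by auto
  have wt: "(\<forall>xs Xs. length Xs = 2 \<longrightarrow> homogeneous xs Xs \<longrightarrow> K Xs \<in> U (sum_list xs + \<kappa>)) \<longleftrightarrow>
    (\<forall>x\<in>degs m. \<forall>y\<in>degs m. \<forall>X\<in>U x. \<forall>Y\<in>U y. K [X, Y] \<in> U (x + y + \<kappa>))"
  proof (intro iffI ballI allI impI)
    fix x y X Y
    assume wt: "\<forall>xs Xs. length Xs = 2 \<longrightarrow> homogeneous xs Xs \<longrightarrow> K Xs \<in> U (sum_list xs + \<kappa>)"
      and "x \<in> degs m" "y \<in> degs m" "X \<in> U x" "Y \<in> U y"
    then have "homogeneous [x, y] [X, Y]" by (simp add: homogeneous_def)
    then show "K [X, Y] \<in> U (x + y + \<kappa>)" using wt[rule_format, of "[X, Y]" "[x, y]"] by simp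
  next
    fix xs Xs
    assume wt: "\<forall>x\<in>degs m. \<forall>y\<in>degs m. \<forall>X\<in>U x. \<forall>Y\<in>U y. K [X, Y] \<in> U (x + y + \<kappa>)"
      and Xs: "length Xs = 2" "homogeneous xs Xs"
    then obtain x y X Y where "xs = [x, y]" "Xs = [X, Y]"
        "x \<in> degs m" "y \<in> degs m" "X \<in> U x" "Y \<in> U y"
      by (auto simp: numeral_2_eq_2 length_Suc_conv homogeneous_def list_all2_Cons2)
    then show "K Xs \<in> U (sum_list xs + \<kappa>)" using wt by simp
  qed
  show ?thesis unfolding multi_maps_def mem_Collect_eq len lin wt by blast
qed

text \<open>
  A single value \<open>f X\<close> is a finite sum of homogeneous endomorphisms since \<open>X\<close> has only finitely many
  nonzero components.
\<close>

lemma linear_in_graded_End: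
  assumes f: "Vector_Spaces.linear s (\<lambda>c D Y. c *s D Y) f"
    and V: "graded_vector_space m s V"
    and weight: "\<And>x. x \<in> degs m \<Longrightarrow> f ` V x \<subseteq> End_deg x"
  shows "range f \<subseteq> graded_End"
proof
  fix D assume "D \<in> range f"
  then obtain X where D: "D = f X" by blast
  interpret V: graded_vector_space m s V by fact
  interpret f: Vector_Spaces.linear s "\<lambda>c D Y. c *s D Y" f by fact
  let ?A = "{x. V.component X x \<noteq> 0}"
  have "D = (\<Sum>x\<in>?A. f (V.component X x))"
    unfolding D by (metis f.sum V.sum_components)
  moreover have "?A \<subseteq> degs m" using V.component_nonzero_degs by blast
  moreover have "\<forall>x\<in>?A. f (V.component X x) \<in> End_deg x"
    using V.component_in V.component_nonzero_degs weight by blast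
  ultimately show "D \<in> graded_End"
    unfolding graded_End_def mem_Collect_eq using V.finite_components by blast
qed

section \<open>The bracket of a bilinear map of weight zero is twice its associator\<close>

text \<open>
  With \<open>k = 1\<close> and weight zero, the sign in front of the second insertion is \<open>-1\<close>, so the two
  insertions add up instead of cancelling.  All signs depending on degrees are trivial.
\<close>

lemma Delta_bracket_eq_0_iff_associative:
  assumes K: "K \<in> multi_maps 1 0"
  shows "Delta_bracket 1 0 K 1 0 K = 0 \<longleftrightarrow>
    (\<forall>x1\<in>degs m. \<forall>x2\<in>degs m. \<forall>x3\<in>degs m. \<forall>X1\<in>U x1. \<forall>X2\<in>U x2. \<forall>X3\<in>U x3.
      K [K [X1, X2], X3] = K [X1, K [X2, X3]])"
proof -
  have formula: "insertion_formula 1 0 K 1 0 K xs [X1, X2, X3] =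
      K [K [X1, X2], X3] - K [X1, K [X2, X3]]" for xs X1 X2 X3
    by (simp add: insertion_formula_def deg_prod_def numeral_2_eq_2 lessThan_Suc)
  have bracket: "Delta_bracket 1 0 K 1 0 K Xs = 0 \<longleftrightarrow> insertion 1 0 K 1 0 K Xs = 0" for Xs
  proof -
    have "Delta_bracket 1 0 K 1 0 K Xs = 2 *s insertion 1 0 K 1 0 K Xs"
      using scale_left_distrib[of 1 1] by (simp add: Delta_bracket_def deg_prod_def)
    then show ?thesis by simp
  qed
  show ?thesis
  proof (intro iffI ballI)
    fix x1 x2 x3 X1 X2 X3
    assume "Delta_bracket 1 0 K 1 0 K = 0"
      and h: "x1 \<in> degs m" "x2 \<in> degs m" "x3 \<in> degs m" "X1 \<in> U x1" "X2 \<in> U x2" "X3 \<in> U x3"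
    then have "insertion 1 0 K 1 0 K [X1, X2, X3] = 0" by (simp flip: bracket)
    moreover have "homogeneous [x1, x2, x3] [X1, X2, X3]" using h by (simp add: homogeneous_def)
    ultimately show "K [K [X1, X2], X3] = K [X1, K [X2, X3]]"
      using insertion_homogeneous[OF K K, of "[x1, x2, x3]" "[X1, X2, X3]"] by (simp add: formula)
  next
    assume assoc: "\<forall>x1\<in>degs m. \<forall>x2\<in>degs m. \<forall>x3\<in>degs m. \<forall>X1\<in>U x1. \<forall>X2\<in>U x2. \<forall>X3\<in>U x3.
      K [K [X1, X2], X3] = K [X1, K [X2, X3]]"
    show "Delta_bracket 1 0 K 1 0 K = 0"
    proof
      fix Xs
      have "insertion 1 0 K 1 0 K Xs = 0"
      proof (cases "length Xs = 3")
        case True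
        then obtain A B C where Xs: "Xs = [A, B, C]"
          by (auto simp: numeral_3_eq_3 length_Suc_conv)
        have "insertion_formula 1 0 K 1 0 K xs (map2 component Xs xs) = 0"
          if xs: "xs \<in> listset (map (\<lambda>X. {x. component X x \<noteq> 0}) Xs)" for xs
        proof -
          obtain a b c where "xs = [a, b, c]" "component A a \<noteq> 0" "component B b \<noteq> 0"
              "component C c \<noteq> 0"
            using xs unfolding Xs by (auto simp: set_Cons_def)
          then show ?thesis
            using assoc component_in component_nonzero_degs unfolding Xs
            by (simp add: formula) blast
        qed
        then show ?thesis by (simp add: insertion_def multilinear_extension_def)
      qed (simp add: insertion_def)
      then show "Delta_bracket 1 0 K 1 0 K Xs = 0 Xs" by (simp add: bracket)
    qed
  qed
qed

end

section \<open>The three products that make up a bilinear map of weight zero on E\<close>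

lemma case_nat_in_degs: "case_nat k x \<in> degs (Suc n) \<longleftrightarrow> x \<in> degs n"
proof -
  have "(\<forall>i\<ge>Suc n. case_nat k x i = 0) \<longleftrightarrow> (\<forall>i\<ge>n. x i = 0)"
    by (metis Suc_le_D Suc_le_mono nat.simps(5))
  then show ?thesis by (simp add: degs_def)
qed

lemma case_nat_add: "case_nat i x + case_nat j y = case_nat (i + j) (x + y)"
  for x y :: "nat \<Rightarrow> 'a::plus"
  by (rule ext) (simp split: nat.split)

lemma E_grading_case_nat:
  "E_grading V W (case_nat 0 x) = V x \<times> {0}"
  "E_grading V W (case_nat 1 x) = {0} \<times> W x"
  "E_grading V W (case_nat 2 x) = {0}"
  by (simp_all add: E_grading_def)

locale graded_product =
  V: graded_vector_space n scaleV V + W: graded_vector_space n scaleW W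
  for n :: nat
    and scaleV :: "'k::field_char_0 \<Rightarrow> 'v::ab_group_add \<Rightarrow> 'v"
    and V :: "(nat \<Rightarrow> int) \<Rightarrow> 'v set"
    and scaleW :: "'k \<Rightarrow> 'w::ab_group_add \<Rightarrow> 'w"
    and W :: "(nat \<Rightarrow> int) \<Rightarrow> 'w set" +
  fixes P :: "('v \<times> 'w) list \<Rightarrow> 'v \<times> 'w"
  assumes P: "P \<in> graded_vector_space.multi_maps (Suc n) (module_prod.scale scaleV scaleW)
    (E_grading V W) 1 0"
begin

sublocale E: graded_vector_space "Suc n" "module_prod.scale scaleV scaleW" "E_grading V W"
  by (rule E_graded) unfold_locales

sublocale VW: vector_space_prod scaleV scaleW
  by unfold_locales

definition prodV :: "'v \<Rightarrow> 'v \<Rightarrow> 'v"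
  where "prodV X1 X2 = fst (P [(X1, 0), (X2, 0)])"

definition left_act :: "'v \<Rightarrow> 'w \<Rightarrow> 'w"
  where "left_act X Y = snd (P [(X, 0), (0, Y)])"

definition right_act :: "'w \<Rightarrow> 'v \<Rightarrow> 'w"
  where "right_act Y X = snd (P [(0, Y), (X, 0)])"

lemma P_add_left: "P [A + B, C] = P [A, C] + P [B, C]"
  and P_add_right: "P [C, A + B] = P [C, A] + P [C, B]"
  and P_scale_left: "P [VW.scale c A, C] = VW.scale c (P [A, C])"
  and P_scale_right: "P [C, VW.scale c A] = VW.scale c (P [C, A])"
proof -
  interpret left: Vector_Spaces.linear VW.scale VW.scale "\<lambda>X. P [X, C]"
    using P unfolding E.multi_maps_1_iff by blast
  interpret right: Vector_Spaces.linear VW.scale VW.scale "\<lambda>X. P [C, X]"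
    using P unfolding E.multi_maps_1_iff by blast
  show "P [A + B, C] = P [A, C] + P [B, C]" by (rule left.add)
  show "P [C, A + B] = P [C, A] + P [C, B]" by (rule right.add)
  show "P [VW.scale c A, C] = VW.scale c (P [A, C])" by (rule left.scale)
  show "P [C, VW.scale c A] = VW.scale c (P [C, A])" by (rule right.scale)
qed

text \<open>
  The integer \<open>i\<close> prefixed to a degree \<open>x\<close> by \<open>case_nat i x\<close> is the extra degree, so that \<open>case_nat 0 x\<close>
  and \<open>case_nat 1 x\<close> are the degrees of \<open>V\<^sup>x\<close> and \<open>W\<^sup>x\<close> in \<open>E\<close>.
\<close>

lemma P_weight:
  assumes "x \<in> degs n" "y \<in> degs n"
    and "A \<in> E_grading V W (case_nat i x)" "B \<in> E_grading V W (case_nat j y)"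
  shows "P [A, B] \<in> E_grading V W (case_nat (i + j) (x + y))"
  using P assms
  by (simp add: E.multi_maps_1_iff case_nat_in_degs flip: case_nat_add)

context
  fixes x y
  assumes x: "x \<in> degs n" and y: "y \<in> degs n"
begin

lemma P_VV:
  assumes "X1 \<in> V x" "X2 \<in> V y"
  shows "P [(X1, 0), (X2, 0)] = (prodV X1 X2, 0)" "prodV X1 X2 \<in> V (x + y)"
  using P_weight[OF x y, of "(X1, 0)" 0 "(X2, 0)" 0] assms
  by (auto simp: E_grading_case_nat prodV_def)

lemma P_VW:
  assumes "X \<in> V x" "Y \<in> W y"
  shows "P [(X, 0), (0, Y)] = (0, left_act X Y)" "left_act X Y \<in> W (x + y)"
  using P_weight[OF x y, of "(X, 0)" 0 "(0, Y)" 1] assms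
  by (auto simp: E_grading_case_nat left_act_def)

lemma P_WV:
  assumes "Y \<in> W x" "X \<in> V y"
  shows "P [(0, Y), (X, 0)] = (0, right_act Y X)" "right_act Y X \<in> W (x + y)"
  using P_weight[OF x y, of "(0, Y)" 1 "(X, 0)" 0] assms
  by (auto simp: E_grading_case_nat right_act_def)

lemma P_WW:
  assumes "Y1 \<in> W x" "Y2 \<in> W y"
  shows "P [(0, Y1), (0, Y2)] = (0, 0)"
  using P_weight[OF x y, of "(0, Y1)" 1 "(0, Y2)" 1] assms
  by (auto simp: E_grading_case_nat zero_prod_def)

end

lemma P_zero: "P [(0, 0), A] = (0, 0)" "P [A, (0, 0)] = (0, 0)"
  using P_add_left[of 0 0 A] P_add_right[of A 0 0] by (simp_all add: zero_prod_def)

lemma P_Pair_add: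
  "P [(X + X', 0), C] = P [(X, 0), C] + P [(X', 0), C]"
  "P [(0, Y + Y'), C] = P [(0, Y), C] + P [(0, Y'), C]"
  "P [C, (X + X', 0)] = P [C, (X, 0)] + P [C, (X', 0)]"
  "P [C, (0, Y + Y')] = P [C, (0, Y)] + P [C, (0, Y')]"
  by (simp_all flip: P_add_left P_add_right)

lemma P_Pair_scale:
  "P [(scaleV c X, 0), C] = VW.scale c (P [(X, 0), C])"
  "P [(0, scaleW c Y), C] = VW.scale c (P [(0, Y), C])"
  "P [C, (scaleV c X, 0)] = VW.scale c (P [C, (X, 0)])"
  "P [C, (0, scaleW c Y)] = VW.scale c (P [C, (0, Y)])"
  using P_scale_left[of c "(X, 0)" C] P_scale_left[of c "(0, Y)" C]
    P_scale_right[of C c "(X, 0)"] P_scale_right[of C c "(0, Y)"]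
  by (simp_all add: VW.scale_prod)

lemma linear_prodV: "Vector_Spaces.linear scaleV scaleV (\<lambda>X1. prodV X1 X2)"
    "Vector_Spaces.linear scaleV scaleV (prodV X1)"
  by (simp_all add: Vector_Spaces.linear_iff prodV_def P_Pair_add P_Pair_scale VW.scale_def
      V.vector_space_axioms W.vector_space_axioms)

lemma linear_left_act: "Vector_Spaces.linear scaleV scaleW (\<lambda>X. left_act X Y)"
    "Vector_Spaces.linear scaleW scaleW (left_act X)"
  by (simp_all add: Vector_Spaces.linear_iff left_act_def P_Pair_add P_Pair_scale VW.scale_def
      V.vector_space_axioms W.vector_space_axioms)

lemma linear_right_act: "Vector_Spaces.linear scaleW scaleW (\<lambda>Y. right_act Y X)"
    "Vector_Spaces.linear scaleV scaleW (right_act Y)"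
  by (simp_all add: Vector_Spaces.linear_iff right_act_def P_Pair_add P_Pair_scale VW.scale_def
      V.vector_space_axioms W.vector_space_axioms)

lemma act_add:
  "left_act (X + X') Y = left_act X Y + left_act X' Y"
  "left_act X (Y + Y') = left_act X Y + left_act X Y'"
  "right_act (Y + Y') X = right_act Y X + right_act Y' X"
  "right_act Y (X + X') = right_act Y X + right_act Y X'"
  using linear_left_act linear_right_act by (auto simp: Vector_Spaces.linear_iff)

lemma act_scale:
  "left_act (scaleV c X) Y = scaleW c (left_act X Y)"
  "left_act X (scaleW c Y) = scaleW c (left_act X Y)"
  "right_act (scaleW c Y) X = scaleW c (right_act Y X)"
  "right_act Y (scaleV c X) = scaleW c (right_act Y X)"
  using linear_left_act linear_right_act by (auto simp: Vector_Spaces.linear_iff)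

text \<open>
  Degrees whose first entry is neither 0 nor 1 contain only \<open>0\<close>, which can be counted as a
  homogeneous element of \<open>V\<close>.
\<close>

lemma E_homogeneous_cases:
  assumes "z \<in> degs (Suc n)" "A \<in> E_grading V W z"
  obtains (V) x X where "x \<in> degs n" "X \<in> V x" "A = (X, 0)"
    | (W) y Y where "y \<in> degs n" "Y \<in> W y" "A = (0, Y)"
proof -
  let ?x = "\<lambda>i. z (Suc i)"
  have x: "?x \<in> degs n" using assms(1) by (simp add: degs_def)
  have "0 \<in> V ?x" using V.subspace_0[OF V.subspace_component[OF x]] .
  then show ?thesis using that x assms(2)
    by (auto simp: E_grading_def zero_prod_def split: if_splits)
qed

text \<open>
  These are the bimodule axioms without Koszul signs: the right action is not yet turned into
  operators written on the left of their argument.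
\<close>

definition bimodule_identities :: bool
  where "bimodule_identities \<longleftrightarrow> (\<forall>x1\<in>degs n. \<forall>x2\<in>degs n. \<forall>x3\<in>degs n.
    (\<forall>X1\<in>V x1. \<forall>X2\<in>V x2. \<forall>X3\<in>V x3. prodV (prodV X1 X2) X3 = prodV X1 (prodV X2 X3)) \<and>
    (\<forall>X1\<in>V x1. \<forall>X2\<in>V x2. \<forall>Y\<in>W x3. left_act (prodV X1 X2) Y = left_act X1 (left_act X2 Y)) \<and>
    (\<forall>X1\<in>V x1. \<forall>Y\<in>W x2. \<forall>X2\<in>V x3. right_act (left_act X1 Y) X2 = left_act X1 (right_act Y X2)) \<and>
    (\<forall>Y\<in>W x1. \<forall>X1\<in>V x2. \<forall>X2\<in>V x3. right_act (right_act Y X1) X2 = right_act Y (prodV X1 X2)))"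

text \<open>
  The identities are the associativity of \<open>P\<close> on triples with at most one entry in \<open>W\<close>.  With two or
  more such entries both bracketings have extra degree at least 2, where \<open>E\<close> vanishes.
\<close>

lemma bracket_eq_0_iff_bimodule_identities:
  "E.Delta_bracket 1 0 P 1 0 P = 0 \<longleftrightarrow> bimodule_identities"
  unfolding E.Delta_bracket_eq_0_iff_associative[OF P]
proof (intro iffI ballI)
  assume assoc: "\<forall>z1\<in>degs (Suc n). \<forall>z2\<in>degs (Suc n). \<forall>z3\<in>degs (Suc n).
    \<forall>A\<in>E_grading V W z1. \<forall>B\<in>E_grading V W z2. \<forall>C\<in>E_grading V W z3.
      P [P [A, B], C] = P [A, P [B, C]]"
  have assoc': "P [P [A, B], C] = P [A, P [B, C]]"
    if "x1 \<in> degs n" "x2 \<in> degs n" "x3 \<in> degs n"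
      "A \<in> E_grading V W (case_nat i x1)" "B \<in> E_grading V W (case_nat j x2)"
      "C \<in> E_grading V W (case_nat k x3)" for x1 x2 x3 i j k A B C
    using assoc[rule_format, OF _ _ _ that(4-6)] that(1-3) by (simp add: case_nat_in_degs)
  show bimodule_identities
    unfolding bimodule_identities_def
  proof (intro ballI conjI)
    fix x1 x2 x3 assume x: "x1 \<in> degs n" "x2 \<in> degs n" "x3 \<in> degs n"
    note a = assoc'[OF x]
    show "prodV (prodV X1 X2) X3 = prodV X1 (prodV X2 X3)"
      if "X1 \<in> V x1" "X2 \<in> V x2" "X3 \<in> V x3" for X1 X2 X3
      using a[of "(X1, 0)" 0 "(X2, 0)" 0 "(X3, 0)" 0] x that
      by (simp add: E_grading_case_nat P_VV[of x1 x2] P_VV[of x2 x3] P_VV[of "x1 + x2" x3]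
          P_VV[of x1 "x2 + x3"] add_in_degs)
    show "left_act (prodV X1 X2) Y = left_act X1 (left_act X2 Y)"
      if "X1 \<in> V x1" "X2 \<in> V x2" "Y \<in> W x3" for X1 X2 Y
      using a[of "(X1, 0)" 0 "(X2, 0)" 0 "(0, Y)" 1] x that
      by (simp add: E_grading_case_nat P_VV[of x1 x2] P_VW[of x2 x3] P_VW[of "x1 + x2" x3]
          P_VW[of x1 "x2 + x3"] add_in_degs)
    show "right_act (left_act X1 Y) X2 = left_act X1 (right_act Y X2)"
      if "X1 \<in> V x1" "Y \<in> W x2" "X2 \<in> V x3" for X1 Y X2
      using a[of "(X1, 0)" 0 "(0, Y)" 1 "(X2, 0)" 0] x that
      by (simp add: E_grading_case_nat P_VW[of x1 x2] P_WV[of x2 x3] P_WV[of "x1 + x2" x3]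
          P_VW[of x1 "x2 + x3"] add_in_degs)
    show "right_act (right_act Y X1) X2 = right_act Y (prodV X1 X2)"
      if "Y \<in> W x1" "X1 \<in> V x2" "X2 \<in> V x3" for Y X1 X2
      using a[of "(0, Y)" 1 "(X1, 0)" 0 "(X2, 0)" 0] x that
      by (simp add: E_grading_case_nat P_WV[of x1 x2] P_VV[of x2 x3] P_WV[of "x1 + x2" x3]
          P_WV[of x1 "x2 + x3"] add_in_degs)
  qed
next
  fix z1 z2 z3 A B C
  assume ids: bimodule_identities
    and z: "z1 \<in> degs (Suc n)" "z2 \<in> degs (Suc n)" "z3 \<in> degs (Suc n)"
    and ABC: "A \<in> E_grading V W z1" "B \<in> E_grading V W z2" "C \<in> E_grading V W z3"
  show "P [P [A, B], C] = P [A, P [B, C]]"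
    using z(1) ABC(1)
  proof (cases rule: E_homogeneous_cases)
    case A: (V x1 X1)
    show ?thesis using z(2) ABC(2)
    proof (cases rule: E_homogeneous_cases)
      case B: (V x2 X2)
      show ?thesis using z(3) ABC(3)
      proof (cases rule: E_homogeneous_cases)
        case C: (V x3 X3)
        show ?thesis using ids A B C unfolding bimodule_identities_def
          by (simp add: P_VV[of x1 x2] P_VV[of x2 x3] P_VV[of "x1 + x2" x3]
              P_VV[of x1 "x2 + x3"] add_in_degs)
      next
        case C: (W x3 Y)
        show ?thesis using ids A B C unfolding bimodule_identities_def
          by (simp add: P_VV[of x1 x2] P_VW[of x2 x3] P_VW[of "x1 + x2" x3]
              P_VW[of x1 "x2 + x3"] add_in_degs)
      qed
    next
      case B: (W x2 Y)
      show ?thesis using z(3) ABC(3)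
      proof (cases rule: E_homogeneous_cases)
        case C: (V x3 X3)
        show ?thesis using ids A B C unfolding bimodule_identities_def
          by (simp add: P_VW[of x1 x2] P_WV[of x2 x3] P_WV[of "x1 + x2" x3]
              P_VW[of x1 "x2 + x3"] add_in_degs)
      next
        case C: (W x3 Y')
        show ?thesis using A B C
          by (simp add: P_VW[of x1 x2] P_WW[of x2 x3] P_WW[of "x1 + x2" x3] P_zero add_in_degs)
      qed
    qed
  next
    case A: (W x1 Y)
    show ?thesis using z(2) ABC(2)
    proof (cases rule: E_homogeneous_cases)
      case B: (V x2 X2)
      show ?thesis using z(3) ABC(3)
      proof (cases rule: E_homogeneous_cases)
        case C: (V x3 X3)
        show ?thesis using ids A B C unfolding bimodule_identities_def
          by (simp add: P_WV[of x1 x2] P_VV[of x2 x3] P_WV[of "x1 + x2" x3]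
              P_WV[of x1 "x2 + x3"] add_in_degs)
      next
        case C: (W x3 Y')
        show ?thesis using A B C
          by (simp add: P_WV[of x1 x2] P_VW[of x2 x3] P_WW[of "x1 + x2" x3]
              P_WW[of x1 "x2 + x3"] add_in_degs)
      qed
    next
      case B: (W x2 Y')
      show ?thesis using z(3) ABC(3)
      proof (cases rule: E_homogeneous_cases)
        case C: (V x3 X3)
        show ?thesis using A B C
          by (simp add: P_WW[of x1 x2] P_WV[of x2 x3] P_WW[of x1 "x2 + x3"] P_zero add_in_degs)
      next
        case C: (W x3 Y'')
        show ?thesis using A B C by (simp add: P_WW[of x1 x2] P_WW[of x2 x3] P_zero)
      qed
    qed
  qed
qed

section \<open>The Koszul signs in the bimodule axioms\<close>

context
  fixes rho :: "'v \<Rightarrow> 'w \<Rightarrow> 'w"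
  assumes rho: "\<And>x y X Y. x \<in> degs n \<Longrightarrow> y \<in> degs n \<Longrightarrow> X \<in> V x \<Longrightarrow> Y \<in> W y \<Longrightarrow>
    rho X Y = scaleW ((-1) powi deg_prod n x y) (right_act Y X)"
  fixes x1 x2 y X1 X2 Y
  assumes degrees: "x1 \<in> degs n" "x2 \<in> degs n" "y \<in> degs n"
    and elements: "X1 \<in> V x1" "X2 \<in> V x2" "Y \<in> W y"
begin

text \<open>
  Moving \<open>X1\<close> past \<open>Y\<close> and then \<open>X2\<close> past both costs the exponent \<open>\<langle>x1,y\<rangle> + \<langle>x2,x1+y\<rangle>\<close>.  The axiom contributes another \<open>\<langle>x1,x2\<rangle>\<close>, which leaves
  \<open>\<langle>x1+x2,y\<rangle>\<close>, the exponent for moving \<open>X1 X2\<close> past \<open>Y\<close>.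
\<close>

lemma rho_product_iff:
  "rho (prodV X1 X2) Y = scaleW ((-1) powi deg_prod n x1 x2) (rho X2 (rho X1 Y)) \<longleftrightarrow>
    right_act (right_act Y X1) X2 = right_act Y (prodV X1 X2)"
proof -
  let ?s = "\<lambda>a. ((-1) powi a :: 'k)"
  have Y1: "right_act Y X1 \<in> W (x1 + y)"
    using P_WV(2)[OF degrees(3,1) elements(3,1)] by (simp add: add.commute)
  have "rho X2 (rho X1 Y) = scaleW (?s (deg_prod n x2 (x1 + y)) * ?s (deg_prod n x1 y))
      (right_act (right_act Y X1) X2)"
    using degrees elements Y1
    by (simp add: rho[of x1 y] rho[of x2 "x1 + y"] add_in_degs act_scale
        W.subspace_scale[OF W.subspace_component])
  moreover have "?s (deg_prod n x1 x2) * (?s (deg_prod n x2 (x1 + y)) * ?s (deg_prod n x1 y)) =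
      (?s (deg_prod n x1 x2) * ?s (deg_prod n x1 x2)) * ?s (deg_prod n (x1 + x2) y)"
    unfolding deg_prod_add_left deg_prod_add_right minus_one_powi_add deg_prod_commute[of n x2 x1]
    by (simp only: mult_ac)
  ultimately have "scaleW (?s (deg_prod n x1 x2)) (rho X2 (rho X1 Y)) =
      scaleW (?s (deg_prod n (x1 + x2) y)) (right_act (right_act Y X1) X2)"
    by (simp only: W.scale_scale power_int_minus_one_mult_self mult_1_left)
  moreover have "rho (prodV X1 X2) Y =
      scaleW (?s (deg_prod n (x1 + x2) y)) (right_act Y (prodV X1 X2))"
    using degrees elements by (simp add: rho[of "x1 + x2" y] P_VV add_in_degs)
  ultimately show ?thesis by (auto simp: W.scale_cancel_left)
qed

text \<open>
  On the right, \<open>X2\<close> moves past both \<open>X1\<close> and \<open>Y\<close>, on the left only past \<open>Y\<close>; the sign of the axiom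
  accounts for the difference \<open>\<langle>x1,x2\<rangle>\<close>.
\<close>

lemma left_act_rho_iff:
  "left_act X1 (rho X2 Y) = scaleW ((-1) powi deg_prod n x1 x2) (rho X2 (left_act X1 Y)) \<longleftrightarrow>
    right_act (left_act X1 Y) X2 = left_act X1 (right_act Y X2)"
proof -
  let ?s = "\<lambda>a. ((-1) powi a :: 'k)"
  have "rho X2 (left_act X1 Y) =
      scaleW (?s (deg_prod n x2 (x1 + y))) (right_act (left_act X1 Y) X2)"
    using degrees elements by (simp add: rho[of x2 "x1 + y"] P_VW add_in_degs)
  moreover have "?s (deg_prod n x1 x2) * ?s (deg_prod n x2 (x1 + y)) =
      (?s (deg_prod n x1 x2) * ?s (deg_prod n x1 x2)) * ?s (deg_prod n x2 y)"
    unfolding deg_prod_add_right minus_one_powi_add deg_prod_commute[of n x2 x1]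
    by (simp only: mult_ac)
  ultimately have "scaleW (?s (deg_prod n x1 x2)) (rho X2 (left_act X1 Y)) =
      scaleW (?s (deg_prod n x2 y)) (right_act (left_act X1 Y) X2)"
    by (simp only: W.scale_scale power_int_minus_one_mult_self mult_1_left)
  moreover have "left_act X1 (rho X2 Y) =
      scaleW (?s (deg_prod n x2 y)) (left_act X1 (right_act Y X2))"
    using degrees elements by (simp add: rho[of x2 y] act_scale)
  ultimately show ?thesis by (auto simp: W.scale_cancel_left)
qed

end

section \<open>Reading the identities off a bimodule, and building a bimodule from them\<close>

text \<open>
  Homogeneous values of \<open>\<mu>\<close>, \<open>\<lambda>\<close> and \<open>\<rho>\<close> are prescribed by \<open>P\<close>, so evaluating the axioms on homogeneous
  elements gives the identities.
\<close>

lemma bimodule_identities_if_bimodule: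
  assumes "defines_bimodule n scaleV V scaleW W P"
  shows bimodule_identities
proof -
  obtain mu lam rho where
    mu: "\<And>x1 x2 X1 X2. x1 \<in> degs n \<Longrightarrow> x2 \<in> degs n \<Longrightarrow> X1 \<in> V x1 \<Longrightarrow> X2 \<in> V x2 \<Longrightarrow>
      (mu [X1, X2], 0) = P [(X1, 0), (X2, 0)]" and
    lam_rho: "\<And>x y X Y. x \<in> degs n \<Longrightarrow> y \<in> degs n \<Longrightarrow> X \<in> V x \<Longrightarrow> Y \<in> W y \<Longrightarrow>
      (0, lam X Y) = P [(X, 0), (0, Y)] \<and>
      (0, rho X Y) = VW.scale ((-1) powi deg_prod n x y) (P [(0, Y), (X, 0)])" and
    B: "multigraded_bimodule n scaleV V scaleW W mu lam rho"
    using assms unfolding defines_bimodule_def by blast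
  interpret B: multigraded_bimodule n scaleV V scaleW W mu lam rho by fact
  have mu': "mu [X1, X2] = prodV X1 X2"
    if "x1 \<in> degs n" "x2 \<in> degs n" "X1 \<in> V x1" "X2 \<in> V x2" for x1 x2 X1 X2
    using mu[OF that] by (simp add: P_VV[OF that])
  have lam: "lam X Y = left_act X Y" and
    rho: "rho X Y = scaleW ((-1) powi deg_prod n x y) (right_act Y X)"
    if "x \<in> degs n" "y \<in> degs n" "X \<in> V x" "Y \<in> W y" for x y X Y
    using lam_rho[OF that] by (simp_all add: P_VW[OF that] P_WV[OF that(2,1,4,3)] VW.scale_def)
  have mu_assoc: "mu [mu [X1, X2], X3] = mu [X1, mu [X2, X3]]"
    if "x1 \<in> degs n" "x2 \<in> degs n" "x3 \<in> degs n" "X1 \<in> V x1" "X2 \<in> V x2" "X3 \<in> V x3"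
    for x1 x2 x3 X1 X2 X3
    using B.mu_bracket that unfolding V.Delta_bracket_eq_0_iff_associative[OF B.mu] by blast
  show ?thesis
    unfolding bimodule_identities_def
  proof (intro ballI conjI)
    fix x1 x2 x3 assume x: "x1 \<in> degs n" "x2 \<in> degs n" "x3 \<in> degs n"
    show "prodV (prodV X1 X2) X3 = prodV X1 (prodV X2 X3)"
      if "X1 \<in> V x1" "X2 \<in> V x2" "X3 \<in> V x3" for X1 X2 X3
      using mu_assoc[OF x that] x that
      by (simp add: mu'[of x1 x2] mu'[of x2 x3] mu'[of "x1 + x2" x3] mu'[of x1 "x2 + x3"]
          P_VV add_in_degs)
    show "left_act (prodV X1 X2) Y = left_act X1 (left_act X2 Y)"
      if "X1 \<in> V x1" "X2 \<in> V x2" "Y \<in> W x3" for X1 X2 Y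
      using fun_cong[OF B.lam_mu[OF x(1,2) that(1,2)], of Y] x that
      by (simp add: mu'[of x1 x2] lam[of x2 x3] lam[of "x1 + x2" x3] lam[of x1 "x2 + x3"]
          P_VV P_VW add_in_degs)
    show "right_act (left_act X1 Y) X2 = left_act X1 (right_act Y X2)"
      if "X1 \<in> V x1" "Y \<in> W x2" "X2 \<in> V x3" for X1 Y X2
    proof -
      have Y': "rho X2 Y \<in> W (x3 + x2)"
        using x that P_WV(2)[OF x(2,3) that(2,3)]
        by (simp add: rho[of x3 x2] add.commute W.subspace_scale[OF W.subspace_component] add_in_degs)
      have "left_act X1 (rho X2 Y) = scaleW ((-1) powi deg_prod n x1 x3) (rho X2 (left_act X1 Y))"
        using fun_cong[OF B.lam_rho[OF x(1,3) that(1,3)], of Y] x that Y'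
        by (simp add: lam[of x1 "x3 + x2"] lam[of x1 x2] add_in_degs)
      then show ?thesis using left_act_rho_iff[OF rho x(1,3,2) that(1,3,2)] by blast
    qed
    show "right_act (right_act Y X1) X2 = right_act Y (prodV X1 X2)"
      if "Y \<in> W x1" "X1 \<in> V x2" "X2 \<in> V x3" for Y X1 X2
    proof -
      have "rho (prodV X1 X2) Y = scaleW ((-1) powi deg_prod n x2 x3) (rho X2 (rho X1 Y))"
        using fun_cong[OF B.rho_mu[OF x(2,3) that(2,3)], of Y] x that by (simp add: mu'[of x2 x3])
      then show ?thesis using rho_product_iff[OF rho x(2,3,1) that(2,3,1)] by blast
    qed
  qed
qed

text \<open>
  The map \<open>\<rho>\<close> has to be linear in \<open>X\<close> and in \<open>Y\<close>, although its sign depends on both degrees.  For fixed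
  \<open>y\<close> the sign is a linear operator on \<open>V\<close>; applying it to \<open>X\<close> makes every summand of
  \<open>signed_right_act\<close> linear in \<open>X\<close>.
\<close>

definition twist :: "(nat \<Rightarrow> int) \<Rightarrow> 'v \<Rightarrow> 'v"
  where "twist y = V.componentwise (\<lambda>x. scaleV ((-1) powi deg_prod n x y))"

definition signed_right_act :: "'v \<Rightarrow> 'w \<Rightarrow> 'w"
  where "signed_right_act X = W.componentwise (\<lambda>y Y. right_act Y (twist y X))"

lemma linear_twist: "Vector_Spaces.linear scaleV scaleV (twist y)"
  unfolding twist_def
  by (rule V.linear_componentwise)
    (simp_all add: V.vector_space_axioms Vector_Spaces.linear_iff V.scale_right_distrib
      V.scale_left_commute)

lemma linear_signed_right_act: "Vector_Spaces.linear scaleW scaleW (signed_right_act X)"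
  unfolding signed_right_act_def
  by (intro W.linear_componentwise W.vector_space_axioms linear_right_act)

lemma signed_right_act_homogeneous:
  assumes "x \<in> degs n" "y \<in> degs n" "X \<in> V x" "Y \<in> W y"
  shows "signed_right_act X Y = scaleW ((-1) powi deg_prod n x y) (right_act Y X)"
proof -
  have "twist y X = scaleV ((-1) powi deg_prod n x y) X"
    unfolding twist_def using assms by (intro V.componentwise_homogeneous) auto
  moreover have "right_act 0 Z = 0" for Z using act_add(3)[of 0 0 Z] by simp
  ultimately show ?thesis
    unfolding signed_right_act_def
    using assms by (simp add: W.componentwise_homogeneous[of y] act_scale)
qed

lemma vector_space_endomorphisms: "vector_space (\<lambda>c (D::'w \<Rightarrow> 'w) Y. scaleW c (D Y))"
  by unfold_locales (auto simp: fun_eq_iff W.scale_right_distrib W.scale_left_distrib)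

lemma linear_left_act_End:
  "Vector_Spaces.linear scaleV (\<lambda>c (D::'w \<Rightarrow> 'w) Y. scaleW c (D Y)) left_act"
  using vector_space_endomorphisms V.vector_space_axioms
  by (auto simp: Vector_Spaces.linear_iff act_add act_scale)

lemma linear_signed_right_act_End:
  "Vector_Spaces.linear scaleV (\<lambda>c (D::'w \<Rightarrow> 'w) Y. scaleW c (D Y)) signed_right_act"
  using vector_space_endomorphisms V.vector_space_axioms linear_twist
  by (auto simp: Vector_Spaces.linear_iff signed_right_act_def W.componentwise_def act_add
      act_scale sum.distrib W.scale_sum_right)

lemma left_act_weight: "x \<in> degs n \<Longrightarrow> left_act ` V x \<subseteq> W.End_deg x"
  using linear_left_act by (auto simp: W.End_deg_def add.commute dest: P_VW(2))

lemma signed_right_act_weight: "x \<in> degs n \<Longrightarrow> signed_right_act ` V x \<subseteq> W.End_deg x"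
  using linear_signed_right_act
  by (auto simp: W.End_deg_def signed_right_act_homogeneous P_WV(2) add_in_degs
      intro!: W.subspace_scale[OF W.subspace_component])

lemma bimodule_if_bimodule_identities:
  assumes ids: bimodule_identities
  shows "defines_bimodule n scaleV V scaleW W P"
proof -
  define mu where "mu Xs = (if length Xs = 2 then prodV (Xs ! 0) (Xs ! 1) else 0)" for Xs
  have mu2: "mu [X1, X2] = prodV X1 X2" for X1 X2 by (simp add: mu_def)
  have mu: "mu \<in> V.multi_maps 1 0"
    using linear_prodV P_VV(2) by (auto simp: V.multi_maps_1_iff mu_def)
  note rho = signed_right_act_homogeneous
  have comp: "Vector_Spaces.linear scaleW scaleW (\<lambda>Y. f (g Y))"
    if "Vector_Spaces.linear scaleW scaleW f" "Vector_Spaces.linear scaleW scaleW g" for f g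
    using that by (simp add: Vector_Spaces.linear_iff)
  have scale_comp: "Vector_Spaces.linear scaleW scaleW (\<lambda>Y. scaleW c (f (g Y)))"
    if "Vector_Spaces.linear scaleW scaleW f" "Vector_Spaces.linear scaleW scaleW g" for c f g
    using that by (simp add: Vector_Spaces.linear_iff W.scale_right_distrib W.scale_left_commute)
  note left = linear_left_act(2) and right = linear_signed_right_act
  have B: "multigraded_bimodule n scaleV V scaleW W mu left_act signed_right_act"
  proof (intro multigraded_bimodule.intro multigraded_bimodule_axioms.intro
      V.graded_vector_space_axioms W.graded_vector_space_axioms)
    show "mu \<in> V.multi_maps 1 0" by fact
    show "Vector_Spaces.linear scaleV (\<lambda>c D Y. scaleW c (D Y)) left_act"
      by (rule linear_left_act_End)
    show "Vector_Spaces.linear scaleV (\<lambda>c D Y. scaleW c (D Y)) signed_right_act"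
      by (rule linear_signed_right_act_End)
    show "left_act ` V x \<subseteq> W.End_deg x" if "x \<in> degs n" for x
      using that by (rule left_act_weight)
    show "signed_right_act ` V x \<subseteq> W.End_deg x" if "x \<in> degs n" for x
      using that by (rule signed_right_act_weight)
    show "range left_act \<subseteq> W.graded_End"
      using linear_left_act_End V.graded_vector_space_axioms left_act_weight
      by (rule W.linear_in_graded_End)
    show "range signed_right_act \<subseteq> W.graded_End"
      using linear_signed_right_act_End V.graded_vector_space_axioms signed_right_act_weight
      by (rule W.linear_in_graded_End)
    show "V.Delta_bracket 1 0 mu 1 0 mu = 0"
      unfolding V.Delta_bracket_eq_0_iff_associative[OF mu] mu2
      using ids by (simp add: bimodule_identities_def)
    fix x1 x2 X1 X2
    assume x: "x1 \<in> degs n" "x2 \<in> degs n" and X: "X1 \<in> V x1" "X2 \<in> V x2"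
    show "left_act (mu [X1, X2]) = left_act X1 \<circ> left_act X2"
      unfolding mu2 comp_def
      using left comp[OF left left]
      by (rule W.linear_eq_on_homogeneous) (use ids x X in \<open>simp add: bimodule_identities_def\<close>)
    show "signed_right_act (mu [X1, X2]) = (\<lambda>Y. scaleW ((-1) powi deg_prod n x1 x2)
        ((signed_right_act X2 \<circ> signed_right_act X1) Y))"
      unfolding mu2 comp_def
      using right scale_comp[OF right right]
    proof (rule W.linear_eq_on_homogeneous)
      fix y Y assume Y: "y \<in> degs n" "Y \<in> W y"
      show "signed_right_act (prodV X1 X2) Y = scaleW ((-1) powi deg_prod n x1 x2)
          (signed_right_act X2 (signed_right_act X1 Y))"
        using rho_product_iff[OF rho x Y(1) X Y(2)] ids x X Y by (simp add: bimodule_identities_def)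
    qed
    show "left_act X1 \<circ> signed_right_act X2 = (\<lambda>Y. scaleW ((-1) powi deg_prod n x1 x2)
        ((signed_right_act X2 \<circ> left_act X1) Y))"
      unfolding comp_def
      using comp[OF left right] scale_comp[OF right left]
    proof (rule W.linear_eq_on_homogeneous)
      fix y Y assume Y: "y \<in> degs n" "Y \<in> W y"
      show "left_act X1 (signed_right_act X2 Y) = scaleW ((-1) powi deg_prod n x1 x2)
          (signed_right_act X2 (left_act X1 Y))"
        using left_act_rho_iff[OF rho x Y(1) X Y(2)] ids x X Y by (simp add: bimodule_identities_def)
    qed
  qed
  show ?thesis
    unfolding defines_bimodule_def
    by (intro exI[of _ mu] exI[of _ left_act] exI[of _ signed_right_act] conjI ballI B)
      (simp_all add: mu2 P_VV P_VW P_WV rho VW.scale_def)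
qed

end

theorem theorem4p2:
  fixes n :: nat
    and scaleV :: "'k::field_char_0 \<Rightarrow> 'v::ab_group_add \<Rightarrow> 'v"
    and V :: "(nat \<Rightarrow> int) \<Rightarrow> 'v set"
    and scaleW :: "'k \<Rightarrow> 'w::ab_group_add \<Rightarrow> 'w"
    and W :: "(nat \<Rightarrow> int) \<Rightarrow> 'w set"
    and P :: "('v \<times> 'w) list \<Rightarrow> 'v \<times> 'w"
  defines "scaleE \<equiv> module_prod.scale scaleV scaleW"
    and "E \<equiv> E_grading V W"
  assumes "graded_vector_space n scaleV V"
    and "graded_vector_space n scaleW W"
    and "P \<in> graded_vector_space.multi_maps (Suc n) scaleE E 1 0"
  shows "defines_bimodule n scaleV V scaleW W P \<longleftrightarrow>
    graded_vector_space.Delta_bracket (Suc n) scaleE E 1 0 P 1 0 P = 0"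
proof -
  interpret graded_product n scaleV V scaleW W P
    using assms(3-5) unfolding scaleE_def E_def
    by (simp add: graded_product_def graded_product_axioms_def)
  show ?thesis
    unfolding scaleE_def E_def bracket_eq_0_iff_bimodule_identities
    using bimodule_identities_if_bimodule bimodule_if_bimodule_identities by blast
qed

end
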